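(* For every object $X$ of the topos of trees $\mathcal T$ let $D X$ be the guarded delay object on $X$, with structure maps $\mathrm{ret}_X:X\to DX$ and $\mathrm{step}_X:\triangleright(DX)\to DX$; for $f:X\to Y$ let $D f:DX\to DY$ be the guarded recursive map action; and for $f : X\to DY$ let $\mathrm{bind}(f):DX\to DY$ be the guarded recursive bind. Then these data form a monad on $\mathcal T$: $X\mapsto DX$, $f\mapsto Df$ is an endofunctor of $\mathcal T$, and $(D,\mathrm{ret},\mu)$ with $\mu_X:=\mathrm{bind}(\mathrm{id}_{DX}):DDX\to DX$ is a monad on $\mathcal T$ (naturality of $\mathrm{ret}$ and $\mu$, the two unit laws and associativity hold).
   Context: $\mathcal T$ is the category of presheaves of sets on $\omega$ (the ordered natural numbers): an object $X$ consists of sets $X(n)$, $n\ge0$, and maps $X(n+1)\to X(n)$. The later functor $\triangleright:\mathcal T\to\mathcal T$ is $\triangleright X(0)=1$, $\triangleright X(n+1)=X(n)$. $DX$ is the guarded recursive object solving $DX\cong X+\triangleright(DX)$ (such a solution exists and is unique up to isomorphism); $\mathrm{ret}_X$ and $\mathrm{step}_X$ are the composites of the left and right coproduct inclusions with the isomorphism $X+\triangleright(DX)\cong DX$. Maps out of $DX$ are defined by guarded recursion (recursive calls only under $\triangleright$, so the component at stage $n+1$ is determined by the one at stage $n$): $Df$ is the unique map with $Df\circ\mathrm{ret}_X=\mathrm{ret}_Y\circ f$ and $Df\circ\mathrm{step}_X=\mathrm{step}_Y\circ\triangleright(Df)$; $\mathrm{bind}(f)$ is the unique map with $\mathrm{bind}(f)\circ\mathrm{ret}_X=f$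 and $\mathrm{bind}(f)\circ\mathrm{step}_X=\mathrm{step}_Y\circ\triangleright(\mathrm{bind}(f))$. *)

theory Defs
  imports Main "HOL-Library.FuncSet"
begin

section \<open>The topos of trees\<close>

text \<open>
  HOL has no universe of all sets, so a presheaf of sets on the ordered naturals has its
  elements in a type of elements. The type is arbitrary and may differ from one object to
  another; the objects of the topos of trees are the presheaves over all such types.
\<close>

record 'a presheaf =
  El :: "nat \<Rightarrow> 'a set"
  res :: "nat \<Rightarrow> 'a \<Rightarrow> 'a"

definition tree_obj :: "'a presheaf \<Rightarrow> bool" where
  "tree_obj X \<longleftrightarrow> (\<forall>n. res X n \<in> El X (Suc n) \<rightarrow> El X n)"

text \<open>
  The components of a morphism are extensional functions (equal to \<^const>\<open>undefined\<close> outside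
  the domain), so that equality of morphisms is equality in HOL.
\<close>

definition tree_hom :: "'a presheaf \<Rightarrow> 'b presheaf \<Rightarrow> (nat \<Rightarrow> 'a \<Rightarrow> 'b) set" where
  "tree_hom X Y = {f. (\<forall>n. f n \<in> El X n \<rightarrow>\<^sub>E El Y n) \<and>
     (\<forall>n. \<forall>x \<in> El X (Suc n). res Y n (f (Suc n) x) = f n (res X n x))}"

definition tree_id :: "'a presheaf \<Rightarrow> nat \<Rightarrow> 'a \<Rightarrow> 'a" where
  "tree_id X n = (\<lambda>x \<in> El X n. x)"

text \<open>Composition \<open>g \<circ> f\<close>, where \<open>X\<close> is the domain of \<open>f\<close>.\<close>

definition tree_comp ::
  "'a presheaf \<Rightarrow> (nat \<Rightarrow> 'b \<Rightarrow> 'c) \<Rightarrow> (nat \<Rightarrow> 'a \<Rightarrow> 'b) \<Rightarrow> nat \<Rightarrow> 'a \<Rightarrow> 'c" where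
  "tree_comp X g f n = compose (El X n) (g n) (f n)"

definition tree_sum :: "'a presheaf \<Rightarrow> 'b presheaf \<Rightarrow> ('a + 'b) presheaf" where
  "tree_sum X Y = \<lparr>El = (\<lambda>n. El X n <+> El Y n), res = (\<lambda>n. map_sum (res X n) (res Y n))\<rparr>"

definition tree_inl :: "'a presheaf \<Rightarrow> nat \<Rightarrow> 'a \<Rightarrow> 'a + 'b" where
  "tree_inl X n = (\<lambda>x \<in> El X n. Inl x)"

definition tree_inr :: "'b presheaf \<Rightarrow> nat \<Rightarrow> 'b \<Rightarrow> 'a + 'b" where
  "tree_inr Y n = (\<lambda>y \<in> El Y n. Inr y)"

definition tree_iso :: "'a presheaf \<Rightarrow> 'b presheaf \<Rightarrow> (nat \<Rightarrow> 'a \<Rightarrow> 'b) \<Rightarrow> bool" where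
  "tree_iso X Y f \<longleftrightarrow> f \<in> tree_hom X Y \<and>
     (\<exists>g \<in> tree_hom Y X. tree_comp X g f = tree_id X \<and> tree_comp Y f g = tree_id Y)"


section \<open>The later functor\<close>

text \<open>
  The terminal set at stage \<open>0\<close> is \<open>{None}\<close>, and \<open>Some\<close> tags the elements of \<open>X n\<close> as
  elements of stage \<open>Suc n\<close>.
\<close>

definition later :: "'a presheaf \<Rightarrow> 'a option presheaf" where
  "later X = \<lparr>El = (\<lambda>n. case n of 0 \<Rightarrow> {None} | Suc m \<Rightarrow> Some ` El X m),
              res = (\<lambda>n. case n of 0 \<Rightarrow> (\<lambda>_. None) | Suc m \<Rightarrow> map_option (res X m))\<rparr>"

definition later_map ::
  "'a presheaf \<Rightarrow> (nat \<Rightarrow> 'a \<Rightarrow> 'b) \<Rightarrow> nat \<Rightarrow> 'a option \<Rightarrow> 'b option" where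
  "later_map X f n =
     (\<lambda>x \<in> El (later X) n. case n of 0 \<Rightarrow> None | Suc m \<Rightarrow> map_option (f m) x)"


section \<open>The guarded delay object\<close>

datatype 'a delay = Roll "'a + 'a delay option"

primrec delay_El :: "'a presheaf \<Rightarrow> nat \<Rightarrow> 'a delay set" where
  "delay_El X 0 = Roll ` (El X 0 <+> {None})"
| "delay_El X (Suc n) = Roll ` (El X (Suc n) <+> Some ` delay_El X n)"

primrec delay_res :: "'a presheaf \<Rightarrow> nat \<Rightarrow> 'a delay \<Rightarrow> 'a delay" where
  "delay_res X 0 = (\<lambda>d. case d of Roll s \<Rightarrow> Roll (map_sum (res X 0) (\<lambda>_. None) s))"
| "delay_res X (Suc n) =
     (\<lambda>d. case d of Roll s \<Rightarrow>
        Roll (map_sum (res X (Suc n)) (map_option (delay_res X n)) s))"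

definition Delay :: "'a presheaf \<Rightarrow> 'a delay presheaf" where
  "Delay X = \<lparr>El = delay_El X, res = delay_res X\<rparr>"

definition delay_roll :: "'a presheaf \<Rightarrow> nat \<Rightarrow> 'a + 'a delay option \<Rightarrow> 'a delay" where
  "delay_roll X n = (\<lambda>s \<in> El (tree_sum X (later (Delay X))) n. Roll s)"

definition delay_ret :: "'a presheaf \<Rightarrow> nat \<Rightarrow> 'a \<Rightarrow> 'a delay" where
  "delay_ret X = tree_comp X (delay_roll X) (tree_inl X)"

definition delay_step :: "'a presheaf \<Rightarrow> nat \<Rightarrow> 'a delay option \<Rightarrow> 'a delay" where
  "delay_step X = tree_comp (later (Delay X)) (delay_roll X) (tree_inr (later (Delay X)))"

text \<open>The two maps below exist and are unique: see \<open>delay_map_ex1\<close> and \<open>delay_bind_ex1\<close>.\<close>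

definition delay_map ::
  "'a presheaf \<Rightarrow> 'b presheaf \<Rightarrow> (nat \<Rightarrow> 'a \<Rightarrow> 'b) \<Rightarrow> nat \<Rightarrow> 'a delay \<Rightarrow> 'b delay" where
  "delay_map X Y f = (THE h. h \<in> tree_hom (Delay X) (Delay Y) \<and>
     tree_comp X h (delay_ret X) = tree_comp X (delay_ret Y) f \<and>
     tree_comp (later (Delay X)) h (delay_step X) =
       tree_comp (later (Delay X)) (delay_step Y) (later_map (Delay X) h))"

definition delay_bind ::
  "'a presheaf \<Rightarrow> 'b presheaf \<Rightarrow> (nat \<Rightarrow> 'a \<Rightarrow> 'b delay) \<Rightarrow> nat \<Rightarrow> 'a delay \<Rightarrow> 'b delay" where
  "delay_bind X Y f = (THE h. h \<in> tree_hom (Delay X) (Delay Y) \<and>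
     tree_comp X h (delay_ret X) = f \<and>
     tree_comp (later (Delay X)) h (delay_step X) =
       tree_comp (later (Delay X)) (delay_step Y) (later_map (Delay X) h))"

definition delay_mu :: "'a presheaf \<Rightarrow> nat \<Rightarrow> 'a delay delay \<Rightarrow> 'a delay" where
  "delay_mu X = delay_bind (Delay X) X (tree_id (Delay X))"


section \<open>The delay object solves its guarded equation\<close>

lemma later_simps [simp]:
  "El (later X) 0 = {None}" "El (later X) (Suc n) = Some ` El X n"
  "res (later X) 0 = (\<lambda>_. None)" "res (later X) (Suc n) = map_option (res X n)"
  by (simp_all add: later_def)

lemma tree_sum_simps [simp]:
  "El (tree_sum X Y) n = El X n <+> El Y n"
  "res (tree_sum X Y) n = map_sum (res X n) (res Y n)"
  by (simp_all add: tree_sum_def)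

lemma El_Delay: "El (Delay X) n = Roll ` El (tree_sum X (later (Delay X))) n"
  by (cases n) (simp_all add: Delay_def)

lemma res_Delay: "res (Delay X) n (Roll s) = Roll (res (tree_sum X (later (Delay X))) n s)"
  by (cases n) (simp_all add: Delay_def)

lemma tree_objD: "tree_obj X \<Longrightarrow> x \<in> El X (Suc n) \<Longrightarrow> res X n x \<in> El X n"
  by (auto simp: tree_obj_def)

lemma tree_hom_mem: "f \<in> tree_hom X Y \<Longrightarrow> x \<in> El X n \<Longrightarrow> f n x \<in> El Y n"
  by (auto simp: tree_hom_def PiE_def)

lemma tree_hom_undef: "f \<in> tree_hom X Y \<Longrightarrow> x \<notin> El X n \<Longrightarrow> f n x = undefined"
  by (auto simp: tree_hom_def PiE_def extensional_def)

lemma tree_hom_nat: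
  "f \<in> tree_hom X Y \<Longrightarrow> x \<in> El X (Suc n) \<Longrightarrow> res Y n (f (Suc n) x) = f n (res X n x)"
  by (auto simp: tree_hom_def)

lemma tree_homI:
  assumes "\<And>n x. x \<in> El X n \<Longrightarrow> f n x \<in> El Y n"
    and "\<And>n x. x \<notin> El X n \<Longrightarrow> f n x = undefined"
    and "\<And>n x. x \<in> El X (Suc n) \<Longrightarrow> res Y n (f (Suc n) x) = f n (res X n x)"
  shows "f \<in> tree_hom X Y"
  using assms by (auto simp: tree_hom_def PiE_def extensional_def)

lemma tree_obj_sum: "tree_obj X \<Longrightarrow> tree_obj Y \<Longrightarrow> tree_obj (tree_sum X Y)"
  by (fastforce simp: tree_obj_def Pi_iff)

lemma tree_obj_later: "tree_obj X \<Longrightarrow> tree_obj (later X)"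
  unfolding tree_obj_def
  by (rule allI, case_tac n) (auto)

lemma tree_obj_Delay:
  assumes "tree_obj X"
  shows "tree_obj (Delay X)"
proof -
  have "\<forall>d \<in> El (Delay X) (Suc n). res (Delay X) n d \<in> El (Delay X) n" for n
  proof (induction n)
    case 0
    show ?case
      using tree_objD[OF assms] by (auto simp: El_Delay[of X "Suc 0"] El_Delay[of X 0] res_Delay)
  next
    case (Suc n)
    show ?case
    proof
      fix d assume "d \<in> El (Delay X) (Suc (Suc n))"
      then obtain s where d: "d = Roll s"
        and "s \<in> El X (Suc (Suc n)) <+> Some ` El (Delay X) (Suc n)"
        by (auto simp: El_Delay[of X "Suc (Suc n)"])
      then have "res (tree_sum X (later (Delay X))) (Suc n) s
          \<in> El (tree_sum X (later (Delay X))) (Suc n)"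
        using tree_objD[OF assms] Suc by auto
      then show "res (Delay X) (Suc n) d \<in> El (Delay X) (Suc n)"
        by (simp only: d res_Delay El_Delay[of X "Suc n"] imageI)
    qed
  qed
  then show ?thesis by (auto simp: tree_obj_def)
qed

lemma delay_roll_iso:
  assumes "tree_obj X"
  shows "tree_iso (tree_sum X (later (Delay X))) (Delay X) (delay_roll X)"
proof -
  let ?S = "tree_sum X (later (Delay X))"
  define g where "g = (\<lambda>n. \<lambda>d \<in> El (Delay X) n. case d of Roll s \<Rightarrow> s)"
  have S: "tree_obj ?S"
    by (intro tree_obj_sum tree_obj_later tree_obj_Delay assms)
  have hom: "delay_roll X \<in> tree_hom ?S (Delay X)"
    by (rule tree_homI) (use tree_objD[OF S] in \<open>auto simp del: tree_sum_simps
        simp: delay_roll_def El_Delay res_Delay\<close>)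
  have homg: "g \<in> tree_hom (Delay X) ?S"
    by (rule tree_homI) (use tree_objD[OF S] in \<open>auto simp del: tree_sum_simps
        simp: g_def El_Delay res_Delay\<close>)
  have "tree_comp ?S g (delay_roll X) = tree_id ?S"
    by (intro ext) (auto simp del: tree_sum_simps
        simp: tree_comp_def tree_id_def compose_def g_def delay_roll_def El_Delay restrict_def)
  moreover have "tree_comp (Delay X) (delay_roll X) g = tree_id (Delay X)"
    by (intro ext) (auto simp del: tree_sum_simps
        simp: tree_comp_def tree_id_def compose_def g_def delay_roll_def El_Delay restrict_def)
  ultimately show ?thesis
    using hom homg by (auto simp: tree_iso_def)
qed

lemma delay_ret_apply: "x \<in> El X n \<Longrightarrow> delay_ret X n x = Roll (Inl x)"
  by (simp add: delay_ret_def tree_comp_def compose_def tree_inl_def delay_roll_def InlI)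

lemma delay_step_apply:
  "d \<in> El (later (Delay X)) n \<Longrightarrow> delay_step X n d = Roll (Inr d)"
  by (simp add: delay_step_def tree_comp_def compose_def tree_inr_def delay_roll_def InrI)

lemma delay_ret_hom:
  assumes "tree_obj X"
  shows "delay_ret X \<in> tree_hom X (Delay X)"
  by (rule tree_homI)
     (use tree_objD[OF assms] in \<open>auto simp: delay_ret_apply El_Delay res_Delay InlI,
      simp add: delay_ret_def tree_comp_def compose_def\<close>)

lemma delay_step_hom:
  assumes "tree_obj X"
  shows "delay_step X \<in> tree_hom (later (Delay X)) (Delay X)"
  by (rule tree_homI)
     (use tree_objD[OF tree_obj_later[OF tree_obj_Delay[OF assms]]]
      in \<open>auto simp: delay_step_apply El_Delay[of X] res_Delay InrI,
      simp add: delay_step_def tree_comp_def compose_def\<close>)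


section \<open>Guarded recursion out of the delay object\<close>

primrec delay_rec :: "(nat \<Rightarrow> 'a \<Rightarrow> 'b) \<Rightarrow> (nat \<Rightarrow> 'b option \<Rightarrow> 'b) \<Rightarrow> nat \<Rightarrow> 'a delay \<Rightarrow> 'b" where
  "delay_rec f g 0 = (\<lambda>d. case d of Roll s \<Rightarrow> case_sum (f 0) (g 0) (map_sum id (\<lambda>_. None) s))"
| "delay_rec f g (Suc n) = (\<lambda>d. case d of Roll s \<Rightarrow>
     case_sum (f (Suc n)) (g (Suc n)) (map_sum id (map_option (delay_rec f g n)) s))"

lemma later_map_apply:
  "later_map X f 0 None = None"
  "x \<in> El X n \<Longrightarrow> later_map X f (Suc n) (Some x) = Some (f n x)"
  by (simp_all add: later_map_def)

lemma El_Delay_cases: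
  assumes "d \<in> El (Delay X) n"
  obtains (ret) x where "x \<in> El X n" "d = delay_ret X n x"
  | (step) e where "e \<in> El (later (Delay X)) n" "d = delay_step X n e"
  using assms unfolding El_Delay[of X n]
  by (auto simp: delay_ret_apply delay_step_apply elim!: PlusE)

lemma tree_comp_eqD:
  "tree_comp X g f = tree_comp X g' f' \<Longrightarrow> x \<in> El X n \<Longrightarrow> g n (f n x) = g' n (f' n x)"
  by (metis compose_eq tree_comp_def)

lemma delay_rec_unique:
  assumes h: "h \<in> tree_hom (Delay X) Z" "tree_comp X h (delay_ret X) = f"
      "tree_comp (later (Delay X)) h (delay_step X) =
         tree_comp (later (Delay X)) g (later_map (Delay X) h)"
    and k: "k \<in> tree_hom (Delay X) Z" "tree_comp X k (delay_ret X) = f"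
      "tree_comp (later (Delay X)) k (delay_step X) =
         tree_comp (later (Delay X)) g (later_map (Delay X) k)"
  shows "h = k"
proof -
  have ret: "h n (delay_ret X n x) = k n (delay_ret X n x)" if "x \<in> El X n" for n x
    using tree_comp_eqD[OF trans[OF h(2) k(2)[symmetric]] that] .
  have eq: "\<forall>d \<in> El (Delay X) n. h n d = k n d" for n
  proof (induction n)
    case 0
    show ?case
    proof
      fix d assume "d \<in> El (Delay X) 0"
      then show "h 0 d = k 0 d"
      proof (cases rule: El_Delay_cases)
        case (step e)
        then show ?thesis
          using tree_comp_eqD[OF h(3) step(1)] tree_comp_eqD[OF k(3) step(1)]
          by (simp add: later_map_apply)
      qed (simp add: ret)
    qed
  next
    case (Suc n)
    show ?case
    proof
      fix d assume "d \<in> El (Delay X) (Suc n)"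
      then show "h (Suc n) d = k (Suc n) d"
      proof (cases rule: El_Delay_cases)
        case (step e)
        then obtain e' where "e' \<in> El (Delay X) n" "e = Some e'"
          by auto
        then show ?thesis
          using tree_comp_eqD[OF h(3) step(1)] tree_comp_eqD[OF k(3) step(1)] step(2) Suc
          by (simp add: later_map_apply)
      qed (simp add: ret)
    qed
  qed
  show ?thesis
  proof (intro ext)
    fix n d
    show "h n d = k n d"
      using eq tree_hom_undef[OF h(1)] tree_hom_undef[OF k(1)] by (cases "d \<in> El (Delay X) n") auto
  qed
qed

lemma delay_rec_ex1:
  assumes X: "tree_obj X" and f: "f \<in> tree_hom X Z" and g: "g \<in> tree_hom (later Z) Z"
  shows "\<exists>!h. h \<in> tree_hom (Delay X) Z \<and> tree_comp X h (delay_ret X) = f \<and>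
    tree_comp (later (Delay X)) h (delay_step X) =
      tree_comp (later (Delay X)) g (later_map (Delay X) h)"
proof -
  let ?D = "Delay X" and ?r = "delay_rec f g"
  define h where "h = (\<lambda>n. \<lambda>d \<in> El ?D n. ?r n d)"
  have D: "tree_obj ?D" by (rule tree_obj_Delay[OF X])
  have r_ret: "?r n (Roll (Inl x)) = f n x" for n x
    by (cases n) simp_all
  have r_step: "?r n (Roll (Inr e)) = g n (later_map ?D h n e)" if "e \<in> El (later ?D) n" for n e
    using that by (cases n) (auto simp: later_map_apply h_def)
  have r_mem: "\<forall>d \<in> El ?D n. ?r n d \<in> El Z n" for n
  proof (induction n)
    case 0
    show ?case
      using tree_hom_mem[OF f] tree_hom_mem[OF g, of None 0] by (auto simp: El_Delay[of X 0])
  next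
    case (Suc n)
    show ?case
      using tree_hom_mem[OF f, of _ "Suc n"] tree_hom_mem[OF g, of _ "Suc n"] Suc
      by (auto simp: El_Delay[of X "Suc n"])
  qed
  have r_nat: "\<forall>d \<in> El ?D (Suc n). res Z n (?r (Suc n) d) = ?r n (res ?D n d)" for n
  proof (induction n)
    case 0
    show ?case
    proof
      fix d assume "d \<in> El ?D (Suc 0)"
      then show "res Z 0 (?r (Suc 0) d) = ?r 0 (res ?D 0 d)"
        using tree_hom_nat[OF f, of _ 0] tree_hom_nat[OF g, of _ 0] r_mem[of 0]
        by (auto simp: El_Delay[of X "Suc 0"] res_Delay)
    qed
  next
    case (Suc n)
    show ?case
    proof
      fix d assume "d \<in> El ?D (Suc (Suc n))"
      then obtain s where d: "d = Roll s"
        and s: "s \<in> El X (Suc (Suc n)) <+> Some ` El ?D (Suc n)"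
        by (auto simp: El_Delay[of X "Suc (Suc n)"])
      from s consider x where "x \<in> El X (Suc (Suc n))" "s = Inl x"
        | e' where "e' \<in> El ?D (Suc n)" "s = Inr (Some e')"
        by (auto elim!: PlusE)
      then show "res Z (Suc n) (?r (Suc (Suc n)) d) = ?r (Suc n) (res ?D (Suc n) d)"
      proof cases
        case (1 x)
        then show ?thesis
          using tree_hom_nat[OF f, of x "Suc n"] by (simp add: d res_Delay)
      next
        case (2 e')
        have "res Z (Suc n) (g (Suc (Suc n)) (Some (?r (Suc n) e'))) =
            g (Suc n) (Some (res Z n (?r (Suc n) e')))"
          using tree_hom_nat[OF g, of "Some (?r (Suc n) e')" "Suc n"] r_mem[of "Suc n"] 2(1)
          by simp
        then show ?thesis
          using Suc 2 by (simp add: d res_Delay)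
      qed
    qed
  qed
  have h_hom: "h \<in> tree_hom ?D Z"
    by (rule tree_homI) (use r_mem r_nat tree_objD[OF D] in \<open>auto simp: h_def\<close>)
  have h_ret: "tree_comp X h (delay_ret X) = f"
  proof (intro ext)
    fix n x
    show "tree_comp X h (delay_ret X) n x = f n x"
      using tree_hom_undef[OF f, of x n] r_ret[of n x]
      by (cases "x \<in> El X n")
         (auto simp: tree_comp_def compose_def h_def delay_ret_apply El_Delay[of X n])
  qed
  have h_step: "tree_comp (later ?D) h (delay_step X) = tree_comp (later ?D) g (later_map ?D h)"
  proof (intro ext)
    fix n e
    show "tree_comp (later ?D) h (delay_step X) n e = tree_comp (later ?D) g (later_map ?D h) n e"
    proof (cases "e \<in> El (later ?D) n")
      case True
      then have "Roll (Inr e) \<in> El ?D n"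
        by (simp add: El_Delay[of X n] InrI)
      then show ?thesis
        using True r_step[OF True]
        by (simp add: tree_comp_def compose_def h_def delay_step_apply)
    qed (simp add: tree_comp_def compose_def)
  qed
  show ?thesis
    using h_hom h_ret h_step delay_rec_unique by blast
qed

lemma tree_comp_hom:
  "f \<in> tree_hom X Y \<Longrightarrow> g \<in> tree_hom Y Z \<Longrightarrow> tree_obj X \<Longrightarrow> tree_comp X g f \<in> tree_hom X Z"
  by (rule tree_homI)
     (auto simp: tree_comp_def compose_def tree_hom_mem tree_hom_nat tree_objD)

lemma delay_map_ex1:
  assumes "tree_obj X" "tree_obj Y" "f \<in> tree_hom X Y"
  shows "\<exists>!h. h \<in> tree_hom (Delay X) (Delay Y) \<and>
     tree_comp X h (delay_ret X) = tree_comp X (delay_ret Y) f \<and>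
     tree_comp (later (Delay X)) h (delay_step X) =
       tree_comp (later (Delay X)) (delay_step Y) (later_map (Delay X) h)"
  by (intro delay_rec_ex1 tree_comp_hom[OF assms(3)] delay_ret_hom delay_step_hom assms)

lemma delay_bind_ex1:
  assumes "tree_obj X" "tree_obj Y" "f \<in> tree_hom X (Delay Y)"
  shows "\<exists>!h. h \<in> tree_hom (Delay X) (Delay Y) \<and>
     tree_comp X h (delay_ret X) = f \<and>
     tree_comp (later (Delay X)) h (delay_step X) =
       tree_comp (later (Delay X)) (delay_step Y) (later_map (Delay X) h)"
  by (intro delay_rec_ex1 delay_step_hom assms)

end

(*
  Delay X is the free object on X among the objects Z with a map later Z -> Z. The maps
  delay_map X Y f and delay_mu X commute with step, and maps commuting with step are closed
  under identities and composition. Both sides of each law (other than those fixing a composite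
  with ret) are therefore step-preserving, so by uniqueness of guarded recursion they are
  equal once they agree on ret, where each side is computed directly.
*)

theory Submission
  imports Defs
begin

lemma tree_comp_apply: "x \<in> El X n \<Longrightarrow> tree_comp X g f n x = g n (f n x)"
  by (simp add: tree_comp_def compose_def)

lemma tree_comp_undef: "x \<notin> El X n \<Longrightarrow> tree_comp X g f n x = undefined"
  by (simp add: tree_comp_def compose_def)

lemma tree_id_apply: "x \<in> El X n \<Longrightarrow> tree_id X n x = x"
  by (simp add: tree_id_def)

text \<open>\<open>tree_comp X\<close> restricts to \<open>El X n\<close>, so off the domain both
  sides are \<open>undefined\<close>.\<close>

lemma tree_comp_eqI:
  assumes "\<And>n x. x \<in> El X n \<Longrightarrow> g n (f n x) = g' n (f' n x)"
  shows "tree_comp X g f = tree_comp X g' f'"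
proof (intro ext)
  fix n x
  show "tree_comp X g f n x = tree_comp X g' f' n x"
    using assms by (cases "x \<in> El X n") (simp_all add: tree_comp_apply tree_comp_undef)
qed

lemma tree_id_hom: "tree_obj X \<Longrightarrow> tree_id X \<in> tree_hom X X"
  by (rule tree_homI) (auto simp: tree_id_def tree_objD)

lemma later_map_mem:
  assumes "f \<in> tree_hom X Y" "e \<in> El (later X) n"
  shows "later_map X f n e \<in> El (later Y) n"
  using assms by (cases n) (auto simp: later_map_apply tree_hom_mem)

lemma later_map_id: "e \<in> El (later X) n \<Longrightarrow> later_map X (tree_id X) n e = e"
  by (cases n) (auto simp: later_map_apply tree_id_apply)

text \<open>Since \<open>f\<close> lands in \<open>Y\<close>, \<open>later_map Y g\<close> is
  evaluated inside its domain; at stage 0 both sides are \<open>None\<close>.\<close>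

lemma later_map_comp:
  assumes "f \<in> tree_hom X Y" "e \<in> El (later X) n"
  shows "later_map X (tree_comp X g f) n e = later_map Y g n (later_map X f n e)"
  using assms by (cases n) (auto simp: later_map_apply tree_comp_apply tree_hom_mem)

text \<open>These are the homomorphisms of algebras for the later functor, with structure maps
  \<open>delay_step\<close>. The equation has the form used in \<open>delay_map\<close> and
  \<open>delay_bind\<close>, so both maps are seen to belong here by unfolding.\<close>

definition step_hom :: "'a presheaf \<Rightarrow> 'b presheaf \<Rightarrow> (nat \<Rightarrow> 'a delay \<Rightarrow> 'b delay) set" where
  "step_hom X Y = {h \<in> tree_hom (Delay X) (Delay Y).
     tree_comp (later (Delay X)) h (delay_step X) =
       tree_comp (later (Delay X)) (delay_step Y) (later_map (Delay X) h)}"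

lemma step_hom_tree_hom: "h \<in> step_hom X Y \<Longrightarrow> h \<in> tree_hom (Delay X) (Delay Y)"
  by (simp add: step_hom_def)

lemma step_hom_apply:
  assumes "h \<in> step_hom X Y" "e \<in> El (later (Delay X)) n"
  shows "h n (delay_step X n e) = delay_step Y n (later_map (Delay X) h n e)"
  using assms by (auto simp: step_hom_def dest: tree_comp_eqD)

text \<open>This is the uniqueness half of freeness. The induction over stages is already inside
  \<open>delay_rec_unique\<close>, so each law below reduces to a computation on
  \<open>delay_ret\<close>.\<close>

lemma step_hom_eqI:
  assumes "h \<in> step_hom X Y" "k \<in> step_hom X Y"
    and "\<And>n x. x \<in> El X n \<Longrightarrow> h n (delay_ret X n x) = k n (delay_ret X n x)"
  shows "h = k"
proof (rule delay_rec_unique)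
  \<comment> \<open>This takes the \<open>f\<close> of \<open>delay_rec_unique\<close> to be the
    composite of \<open>k\<close> with \<open>delay_ret X\<close>, so its equation for
    \<open>k\<close> is reflexivity.\<close>
  show "tree_comp X h (delay_ret X) = tree_comp X k (delay_ret X)"
    by (rule tree_comp_eqI) (rule assms(3))
qed (use assms(1,2) in \<open>auto simp: step_hom_def\<close>)

lemma step_hom_id:
  assumes "tree_obj X"
  shows "tree_id (Delay X) \<in> step_hom X X"
proof -
  have "tree_comp (later (Delay X)) (tree_id (Delay X)) (delay_step X) =
      tree_comp (later (Delay X)) (delay_step X) (later_map (Delay X) (tree_id (Delay X)))"
    by (rule tree_comp_eqI)
       (simp add: later_map_id tree_id_apply tree_hom_mem[OF delay_step_hom[OF assms]])
  then show ?thesis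
    by (simp add: step_hom_def tree_id_hom tree_obj_Delay assms)
qed

lemma step_hom_comp:
  assumes X: "tree_obj X" and h: "h \<in> step_hom X Y" and k: "k \<in> step_hom Y Z"
  shows "tree_comp (Delay X) k h \<in> step_hom X Z"
proof -
  let ?D = "Delay X"
  note h' = step_hom_tree_hom[OF h] and k' = step_hom_tree_hom[OF k]
  have "tree_comp (later ?D) (tree_comp ?D k h) (delay_step X) =
      tree_comp (later ?D) (delay_step Z) (later_map ?D (tree_comp ?D k h))"
  proof (rule tree_comp_eqI)
    fix n e assume e: "e \<in> El (later ?D) n"
    then have "tree_comp ?D k h n (delay_step X n e) = k n (h n (delay_step X n e))"
      by (simp add: tree_comp_apply tree_hom_mem[OF delay_step_hom[OF X]])
    \<comment> \<open>First \<open>h\<close> passes \<open>delay_step\<close>, replacing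
      \<open>e\<close> by its image under \<open>later_map\<close>; \<open>later_map_mem\<close>
      puts this image in \<open>later (Delay Y)\<close>, where \<open>k\<close> can pass as
      well.\<close>
    also have "\<dots> = delay_step Z n (later_map (Delay Y) k n (later_map ?D h n e))"
      by (simp add: step_hom_apply[OF h e] step_hom_apply[OF k] later_map_mem[OF h' e])
    finally show "tree_comp ?D k h n (delay_step X n e) =
        delay_step Z n (later_map ?D (tree_comp ?D k h) n e)"
      by (simp add: later_map_comp[OF h' e])
  qed
  then show ?thesis
    by (simp add: step_hom_def tree_comp_hom[OF h' k'] tree_obj_Delay X)
qed

lemma delay_map_props:
  assumes "tree_obj X" "tree_obj Y" "f \<in> tree_hom X Y"
  shows delay_map_step_hom: "delay_map X Y f \<in> step_hom X Y"
    and delay_map_comp_ret: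
      "tree_comp X (delay_map X Y f) (delay_ret X) = tree_comp X (delay_ret Y) f"
  using theI'[OF delay_map_ex1[OF assms]] by (simp_all add: delay_map_def step_hom_def)

lemma delay_map_ret:
  assumes "tree_obj X" "tree_obj Y" "f \<in> tree_hom X Y" "x \<in> El X n"
  shows "delay_map X Y f n (delay_ret X n x) = delay_ret Y n (f n x)"
  using tree_comp_eqD[OF delay_map_comp_ret[OF assms(1-3)] assms(4)] .

text \<open>As \<open>delay_mu\<close> binds the identity, the equation of bind on
  \<open>delay_ret\<close> is itself a unit law.\<close>

lemma delay_mu_props:
  assumes "tree_obj X"
  shows delay_mu_step_hom: "delay_mu X \<in> step_hom (Delay X) X"
    and delay_mu_comp_ret:
      "tree_comp (Delay X) (delay_mu X) (delay_ret (Delay X)) = tree_id (Delay X)"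
  using theI'[OF delay_bind_ex1[OF tree_obj_Delay[OF assms] assms tree_id_hom[OF tree_obj_Delay[OF assms]]]]
  by (simp_all add: delay_mu_def delay_bind_def step_hom_def)

lemma delay_mu_ret:
  assumes "tree_obj X" "d \<in> El (Delay X) n"
  shows "delay_mu X n (delay_ret (Delay X) n d) = d"
  using fun_cong[OF fun_cong[OF delay_mu_comp_ret[OF assms(1)]], of n d] assms(2)
  by (simp add: tree_comp_apply tree_id_apply)

lemmas delay_ret_mem = tree_hom_mem[OF delay_ret_hom]
lemmas delay_map_hom = step_hom_tree_hom[OF delay_map_step_hom]
lemmas delay_mu_hom = step_hom_tree_hom[OF delay_mu_step_hom]

lemma delay_map_id:
  assumes X: "tree_obj X"
  shows "delay_map X X (tree_id X) = tree_id (Delay X)"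
  by (rule step_hom_eqI[OF delay_map_step_hom step_hom_id])
     (simp_all add: X tree_id_hom delay_map_ret tree_id_apply delay_ret_mem)

text \<open>Both sides send \<open>delay_ret X n x\<close> to
  \<open>delay_ret Z n (g n (f n x))\<close>.\<close>

lemma delay_map_comp:
  assumes X: "tree_obj X" and Y: "tree_obj Y" and Z: "tree_obj Z"
    and f: "f \<in> tree_hom X Y" and g: "g \<in> tree_hom Y Z"
  shows "delay_map X Z (tree_comp X g f) =
    tree_comp (Delay X) (delay_map Y Z g) (delay_map X Y f)"
  by (rule step_hom_eqI[OF delay_map_step_hom step_hom_comp[OF _ delay_map_step_hom delay_map_step_hom]])
     (simp_all add: X Y Z f g tree_comp_hom[OF f g] delay_map_ret tree_comp_apply delay_ret_mem
       tree_hom_mem[OF f])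

text \<open>The source is free over \<open>Delay X\<close>, so the test elements are
  \<open>delay_ret (Delay X) n d\<close>. On the left \<open>delay_mu X\<close> strips the ret
  before the map acts; on the right the map acts under the ret, which \<open>delay_mu Y\<close> then
  strips. Both give \<open>delay_map X Y f n d\<close>.\<close>

lemma delay_mu_natural:
  assumes X: "tree_obj X" and Y: "tree_obj Y" and f: "f \<in> tree_hom X Y"
  shows "tree_comp (Delay (Delay X)) (delay_map X Y f) (delay_mu X) =
    tree_comp (Delay (Delay X)) (delay_mu Y) (delay_map (Delay X) (Delay Y) (delay_map X Y f))"
proof -
  note DX = tree_obj_Delay[OF X] and DY = tree_obj_Delay[OF Y] and Df = delay_map_hom[OF X Y f]
  show ?thesis
    by (rule step_hom_eqI[OF step_hom_comp[OF DX delay_mu_step_hom delay_map_step_hom]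
          step_hom_comp[OF DX delay_map_step_hom delay_mu_step_hom]])
       (simp_all add: X Y f DX DY Df tree_comp_apply delay_ret_mem delay_map_ret delay_mu_ret
         tree_hom_mem[OF Df])
qed

text \<open>The map turns \<open>delay_ret X n x\<close> into a double ret, and
  \<open>delay_mu X\<close> removes the outer one.\<close>

lemma delay_mu_map_ret:
  assumes X: "tree_obj X"
  shows "tree_comp (Delay X) (delay_mu X) (delay_map X (Delay X) (delay_ret X)) = tree_id (Delay X)"
  by (rule step_hom_eqI[OF step_hom_comp[OF X delay_map_step_hom delay_mu_step_hom] step_hom_id])
     (simp_all add: X tree_obj_Delay delay_ret_hom tree_comp_apply tree_id_apply delay_ret_mem
       delay_map_ret delay_mu_ret)

text \<open>The source is free over \<open>Delay (Delay X)\<close>. On the ret of \<open>d\<close>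
  both sides give \<open>delay_mu X n d\<close>: the left applies \<open>delay_mu X\<close> under
  the ret and then strips it, the right strips it first.\<close>

lemma delay_mu_assoc:
  assumes X: "tree_obj X"
  shows "tree_comp (Delay (Delay (Delay X))) (delay_mu X)
      (delay_map (Delay (Delay X)) (Delay X) (delay_mu X)) =
    tree_comp (Delay (Delay (Delay X))) (delay_mu X) (delay_mu (Delay X))"
proof -
  note DX = tree_obj_Delay[OF X]
  note DDX = tree_obj_Delay[OF DX] and mu = delay_mu_hom[OF X]
  show ?thesis
    by (rule step_hom_eqI[OF step_hom_comp[OF DDX delay_map_step_hom delay_mu_step_hom]
          step_hom_comp[OF DDX delay_mu_step_hom delay_mu_step_hom]])
       (simp_all add: X DX DDX mu tree_comp_apply delay_ret_mem delay_map_ret delay_mu_ret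
         tree_hom_mem[OF mu])
qed

theorem mainTheorem2:
  shows
    "(\<forall>X :: 'a presheaf. tree_obj X \<longrightarrow> tree_obj (Delay X)) \<and>
     (\<forall>(X :: 'a presheaf) (Y :: 'b presheaf) f.
        tree_obj X \<and> tree_obj Y \<and> f \<in> tree_hom X Y \<longrightarrow>
        delay_map X Y f \<in> tree_hom (Delay X) (Delay Y)) \<and>
     (\<forall>X :: 'a presheaf. tree_obj X \<longrightarrow> delay_map X X (tree_id X) = tree_id (Delay X)) \<and>
     (\<forall>(X :: 'a presheaf) (Y :: 'b presheaf) (Z :: 'c presheaf) f g.
        tree_obj X \<and> tree_obj Y \<and> tree_obj Z \<and> f \<in> tree_hom X Y \<and> g \<in> tree_hom Y Z \<longrightarrow>
        delay_map X Z (tree_comp X g f) =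
          tree_comp (Delay X) (delay_map Y Z g) (delay_map X Y f)) \<and>
     (\<forall>X :: 'a presheaf. tree_obj X \<longrightarrow> delay_ret X \<in> tree_hom X (Delay X)) \<and>
     (\<forall>(X :: 'a presheaf) (Y :: 'b presheaf) f.
        tree_obj X \<and> tree_obj Y \<and> f \<in> tree_hom X Y \<longrightarrow>
        tree_comp X (delay_map X Y f) (delay_ret X) = tree_comp X (delay_ret Y) f) \<and>
     (\<forall>X :: 'a presheaf. tree_obj X \<longrightarrow>
        delay_mu X \<in> tree_hom (Delay (Delay X)) (Delay X)) \<and>
     (\<forall>(X :: 'a presheaf) (Y :: 'b presheaf) f.
        tree_obj X \<and> tree_obj Y \<and> f \<in> tree_hom X Y \<longrightarrow>
        tree_comp (Delay (Delay X)) (delay_map X Y f) (delay_mu X) =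
          tree_comp (Delay (Delay X)) (delay_mu Y)
            (delay_map (Delay X) (Delay Y) (delay_map X Y f))) \<and>
     (\<forall>X :: 'a presheaf. tree_obj X \<longrightarrow>
        tree_comp (Delay X) (delay_mu X) (delay_ret (Delay X)) = tree_id (Delay X) \<and>
        tree_comp (Delay X) (delay_mu X) (delay_map X (Delay X) (delay_ret X)) =
          tree_id (Delay X) \<and>
        tree_comp (Delay (Delay (Delay X))) (delay_mu X)
            (delay_map (Delay (Delay X)) (Delay X) (delay_mu X)) =
          tree_comp (Delay (Delay (Delay X))) (delay_mu X) (delay_mu (Delay X)))"
  by (intro conjI allI impI; (elim conjE)?)
     (simp_all add: tree_obj_Delay delay_map_hom delay_map_id delay_map_comp delay_ret_hom
       delay_map_comp_ret delay_mu_hom delay_mu_natural delay_mu_comp_ret delay_mu_map_ret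
       delay_mu_assoc)

end
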